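(* Let $\mu_1,\dots,\mu_r$ be a system of bivariate measures, all absolutely continuous with respect to a common measure $\mu$, $d\mu_j=w_j(x,y)\,d\mu$, and let $\vec n,\vec m\in\mathbb{N}^r$ be two normal multi-indices. Then the bivariate Type II multiple orthogonal polynomial $P_{\vec n}$ and the bivariate Type I function $Q_{\vec m}$ satisfy $$\langle P_{\vec n},Q_{\vec m}\rangle_\mu=\begin{cases}0&\text{if }\vec m\le\vec n\text{ (componentwise)},\\0&\text{if }|\vec n|\le|\vec m|-2,\\1&\text{if }|\vec n|=|\vec m|-1.\end{cases}$$
   Context: Here $\mathbb{N}=\{0,1,2,\dots\}$ and $|\vec n|=n_1+\dots+n_r$. All measures on $\mathbb{R}^2$ are assumed to have finite moments; $\langle f,g\rangle_j=\int fg\,d\mu_j$ and $\langle f,g\rangle_\mu=\int fg\,d\mu$. The common measure $\mu$ has support $\Omega=\bigcup_j\operatorname{supp}(\mu_j)$. The Cantor pairing function is the bijection $\pi:\mathbb{N}^2\to\mathbb{N}$, $\pi(t,s)=\frac12(t+s)(t+s+1)+s$, giving the position (starting at $0$) of $x^ty^s$ in the list $1,x,y,x^2,xy,y^2,\dots$. Write $e_k(x,y)=x^ty^s$ with $(t,s)=\pi^{-1}(k)$. Type II: the bivariate Type II multiple orthogonal polynomial associated to $\vec n$ is the monic polynomial $P_{\vec n}=e_{|\vec n|}+\sum_{k=0}^{|\vec n|-1}c_ke_k$ such that $\langle P_{\vec n},x^ty^s\rangle_j=0$ whenever $0\le\pi(t,s)\le n_j-1$, $j=1,\dots,r$. Type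 I: the bivariate Type I multiple orthogonal polynomials associated to $\vec n$ are polynomials $A_{\vec n,j}=\sum_{k=0}^{n_j-1}c_{k,j}e_k$, $j=1,\dots,r$ (with $A_{\vec n,j}=0$ if $n_j=0$), such that $\sum_{j=1}^r\langle A_{\vec n,j},x^ty^s\rangle_j$ equals $0$ if $0\le\pi(t,s)\le|\vec n|-2$ and $1$ if $\pi(t,s)=|\vec n|-1$. The bivariate Type I function is $Q_{\vec n}=\sum_{j=1}^rA_{\vec n,j}w_j$. A multi-index $\vec n$ is normal if $P_{\vec n}$ exists and is unique; equivalently, if the $A_{\vec n,1},\dots,A_{\vec n,r}$ exist and are unique; equivalently, if the $|\vec n|\times|\vec n|$ matrix $\left(M^{(1)}_{n_1}|\cdots|M^{(r)}_{n_r}\right)$ is regular, where $M^{(j)}_{n_j}$ is the $|\vec n|\times n_j$ matrix with $(k,l)$ entry (from $0$) $\int e_ke_l\,d\mu_j$. *)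

theory Defs
  imports
    "HOL-Analysis.Analysis"
    "HOL-Computational_Algebra.Polynomial"
    "HOL-Library.Nat_Bijection"
begin

definition cantor_pairing :: "nat \<times> nat \<Rightarrow> nat" where
  "cantor_pairing = (\<lambda>(t, s). (t + s) * (t + s + 1) div 2 + s)"

text \<open>The library's \<open>prod_encode\<close> is the Cantor pairing with the two arguments exchanged.\<close>

lemma cantor_pairing_prod_encode: "cantor_pairing (t, s) = prod_encode (s, t)"
  by (simp add: cantor_pairing_def prod_encode_def triangle_def add.commute)

lemma bij_cantor_pairing: "bij cantor_pairing"
proof -
  have "cantor_pairing = prod_encode \<circ> prod.swap"
    by (auto simp: fun_eq_iff cantor_pairing_prod_encode)
  then show ?thesis
    by (metis bij_comp bij_prod_encode bij_swap)
qed

text \<open>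
  Bivariate polynomials are elements of \<open>real poly poly\<close>; the outer indeterminate is \<open>x\<close>, the
  inner one is \<open>y\<close>, and so \<open>monom (monom 1 s) t\<close> is the monomial with exponent \<open>t\<close> in \<open>x\<close> and
  exponent \<open>s\<close> in \<open>y\<close>.
\<close>

type_synonym bipoly = "real poly poly"

definition bimonom :: "nat \<Rightarrow> nat \<Rightarrow> bipoly" where
  "bimonom t s = monom (monom 1 s) t"

definition bieval :: "bipoly \<Rightarrow> real \<times> real \<Rightarrow> real" where
  "bieval p = (\<lambda>(x, y). poly (poly p [:x:]) y)"

lemma bieval_bimonom: "bieval (bimonom t s) (x, y) = x ^ t * y ^ s"
  by (simp add: bieval_def bimonom_def poly_monom poly_const_pow[symmetric] mult.commute)

definition basis_monom :: "nat \<Rightarrow> bipoly" where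
  "basis_monom k = (case inv cantor_pairing k of (t, s) \<Rightarrow> bimonom t s)"

lemma basis_monom_cantor_pairing: "basis_monom (cantor_pairing (t, s)) = bimonom t s"
  by (simp add: basis_monom_def bij_is_inj[OF bij_cantor_pairing])

text \<open>The polynomial with coefficients \<open>c\<close> in the first \<open>N\<close> elements of the graded monomial basis.\<close>

definition lin_comb :: "nat \<Rightarrow> (nat \<Rightarrow> real) \<Rightarrow> bipoly" where
  "lin_comb N c = (\<Sum>k<N. smult [:c k:] (basis_monom k))"

definition bivariate_measure :: "(real \<times> real) measure \<Rightarrow> bool" where
  "bivariate_measure M \<longleftrightarrow>
     sets M = sets borel \<and> (\<forall>t s. integrable M (\<lambda>(x, y). x ^ t * y ^ s))"

definition msupport :: "'a::topological_space measure \<Rightarrow> 'a set" where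
  "msupport M = {p. \<forall>U. open U \<and> p \<in> U \<longrightarrow> emeasure M U > 0}"

definition pairing ::
    "(real \<times> real) measure \<Rightarrow> (real \<times> real \<Rightarrow> real) \<Rightarrow> (real \<times> real \<Rightarrow> real) \<Rightarrow> real" where
  "pairing M f g = (\<integral>p. f p * g p \<partial>M)"

text \<open>
  A system of \<open>r\<close> measures is a family indexed by a finite type with \<open>r\<close> elements, and multi-indices
  are functions from that type to \<open>nat\<close>; the order \<open>\<le>\<close> on them is the componentwise one.
\<close>

definition msize :: "('r::finite \<Rightarrow> nat) \<Rightarrow> nat" where
  "msize n = (\<Sum>j\<in>UNIV. n j)"

definition is_type_II ::
    "('r::finite \<Rightarrow> (real \<times> real) measure) \<Rightarrow> ('r \<Rightarrow> nat) \<Rightarrow> bipoly \<Rightarrow> bool" where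
  "is_type_II M n P \<longleftrightarrow>
     (\<exists>c. P = basis_monom (msize n) + lin_comb (msize n) c) \<and>
     (\<forall>j t s. cantor_pairing (t, s) < n j \<longrightarrow>
        pairing (M j) (bieval P) (bieval (bimonom t s)) = 0)"

definition normal_index ::
    "('r::finite \<Rightarrow> (real \<times> real) measure) \<Rightarrow> ('r \<Rightarrow> nat) \<Rightarrow> bool" where
  "normal_index M n \<longleftrightarrow> (\<exists>!P. is_type_II M n P)"

definition type_II ::
    "('r::finite \<Rightarrow> (real \<times> real) measure) \<Rightarrow> ('r \<Rightarrow> nat) \<Rightarrow> bipoly" where
  "type_II M n = (THE P. is_type_II M n P)"

text \<open>
  The bounds are written additively because subtraction on \<open>nat\<close> truncates: for \<open>msize n = 0\<close>
  both orthogonality conditions are void.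
\<close>

definition is_type_I ::
    "('r::finite \<Rightarrow> (real \<times> real) measure) \<Rightarrow> ('r \<Rightarrow> nat) \<Rightarrow> ('r \<Rightarrow> bipoly) \<Rightarrow> bool" where
  "is_type_I M n A \<longleftrightarrow>
     (\<forall>j. \<exists>c. A j = lin_comb (n j) c) \<and>
     (\<forall>t s. cantor_pairing (t, s) + 2 \<le> msize n \<longrightarrow>
        (\<Sum>j\<in>UNIV. pairing (M j) (bieval (A j)) (bieval (bimonom t s))) = 0) \<and>
     (\<forall>t s. cantor_pairing (t, s) + 1 = msize n \<longrightarrow>
        (\<Sum>j\<in>UNIV. pairing (M j) (bieval (A j)) (bieval (bimonom t s))) = 1)"

definition type_I ::
    "('r::finite \<Rightarrow> (real \<times> real) measure) \<Rightarrow> ('r \<Rightarrow> nat) \<Rightarrow> 'r \<Rightarrow> bipoly" where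
  "type_I M n = (THE A. is_type_I M n A)"

definition type_I_function ::
    "('r::finite \<Rightarrow> (real \<times> real) measure) \<Rightarrow> ('r \<Rightarrow> real \<times> real \<Rightarrow> real) \<Rightarrow>
     ('r \<Rightarrow> nat) \<Rightarrow> real \<times> real \<Rightarrow> real" where
  "type_I_function M w n = (\<lambda>p. \<Sum>j\<in>UNIV. bieval (type_I M n j) p * w j p)"

end

theory Submission
  imports Defs "Jordan_Normal_Form.Determinant"
begin

text \<open>
  Because \<open>M j\<close> has density \<open>w j\<close> with respect to \<open>\<mu>\<close>, the pairing of \<open>P\<close> with the Type I function
  is \<open>\<Sum>j. pairing (M j) P (A j)\<close>, where \<open>P\<close> is the Type II polynomial of \<open>n\<close> and \<open>A\<close> is the tuple
  of Type I polynomials of \<open>m\<close> (lemma \<open>pairing_type_I_function\<close>). This sum can be expanded in two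
  ways. If \<open>m \<le> n\<close>, each \<open>A j\<close> is a combination of the first \<open>m j \<le> n j\<close> monomials, and \<open>P\<close> is
  orthogonal to all of them with respect to \<open>M j\<close>. If \<open>msize n < msize m\<close>, the polynomial \<open>P\<close> is
  instead expanded in the first \<open>msize n + 1\<close> monomials, with leading coefficient 1, and the Type I
  conditions annihilate every term except possibly the leading one, which contributes 1 exactly
  when \<open>msize n + 1 = msize m\<close>.

  Normality is defined by the unique existence of the Type II polynomial, so the Type I conditions
  first have to be shown to have a unique solution. The coefficients of the Type II polynomial solve
  a square linear system, and those of the Type I polynomials solve a system whose matrix is the
  transpose. Uniqueness of the former makes the matrix regular, and hence the latter uniquely
  solvable (lemmas \<open>trivial_left_kernel_imp_uniquely_solvable\<close> and
  \<open>normal_index_imp_unique_type_I\<close>).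
\<close>

(* The symbol $ denotes the component of a vector of variable dimension below. *)
unbundle no vec_syntax

section \<open>Square linear systems and their transposes\<close>

text \<open>
  The columns are indexed by an arbitrary finite set, because the columns of the moment matrix
  carry a double index. After an enumeration of that set, the hypothesis says that the determinant
  does not vanish, a condition invariant under transposition.
\<close>

lemma trivial_left_kernel_imp_uniquely_solvable:
  fixes a :: "nat \<Rightarrow> 'b \<Rightarrow> 'a::field" and b :: "nat \<Rightarrow> 'a"
  assumes "finite J" and card_J: "card J = N"
    and kernel: "\<forall>c. (\<forall>j\<in>J. (\<Sum>k<N. c k * a k j) = 0) \<longrightarrow> (\<forall>k<N. c k = 0)"
  shows "\<exists>d. \<forall>k<N. (\<Sum>j\<in>J. d j * a k j) = b k"
    and "\<And>d j. (\<And>k. k < N \<Longrightarrow> (\<Sum>j\<in>J. d j * a k j) = 0) \<Longrightarrow> j \<in> J \<Longrightarrow> d j = 0"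
proof -
  obtain h where h: "bij_betw h {0..<N} J"
    using ex_bij_betw_nat_finite[OF \<open>finite J\<close>] card_J by auto
  define A where "A = mat N N (\<lambda>(i, k). a k (h i))"
  have A: "A \<in> carrier_mat N N" by (simp add: A_def)
  have sum_h: "(\<Sum>j\<in>J. f j) = (\<Sum>i = 0..<N. f (h i))" for f :: "'b \<Rightarrow> 'a"
    using sum.reindex_bij_betw[OF h, of f] by simp
  have row: "(A\<^sup>T *\<^sub>v v) $ k = (\<Sum>i = 0..<N. v $ i * a k (h i))"
    if "v \<in> carrier_vec N" "k < N" for v k
    using that by (auto simp: A_def scalar_prod_def mult.commute intro!: sum.cong)
  have "det A \<noteq> 0"
  proof
    assume "det A = 0"
    then obtain v where v: "v \<in> carrier_vec N" "v \<noteq> 0\<^sub>v N" "A *\<^sub>v v = 0\<^sub>v N"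
      using det_0_iff_vec_prod_zero[OF A] by auto
    have "(\<Sum>k<N. v $ k * a k j) = 0" if "j \<in> J" for j
    proof -
      obtain i where i: "i < N" "j = h i"
        using \<open>j \<in> J\<close> h by (auto simp: bij_betw_def)
      have "(\<Sum>k<N. v $ k * a k j) = (A *\<^sub>v v) $ i"
        using i v(1) by (auto simp: A_def scalar_prod_def mult.commute atLeast0LessThan intro!: sum.cong)
      then show ?thesis using v(3) i by simp
    qed
    then have "v $ k = 0" if "k < N" for k
      using spec[OF kernel, of "\<lambda>k. v $ k"] that by simp
    then have "v = 0\<^sub>v N" using v(1) by auto
    then show False using v(2) by simp
  qed
  then have det: "det A\<^sup>T \<noteq> 0" using det_transpose[OF A] by simp
  have AT: "A\<^sup>T \<in> carrier_mat N N" using A by simp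
  from det_non_zero_imp_unit[OF AT det, of undefined]
  obtain B where B: "B \<in> carrier_mat N N" "A\<^sup>T * B = 1\<^sub>m N"
    unfolding Units_def ring_mat_def by auto
  have inv_h: "inv_into {0..<N} h (h i) = i" if "i < N" for i
    using bij_betw_inv_into_left[OF h] that by simp
  show "\<exists>d. \<forall>k<N. (\<Sum>j\<in>J. d j * a k j) = b k"
  proof (intro exI allI impI)
    fix k assume "k < N"
    define v where "v = B *\<^sub>v vec N b"
    have v: "v \<in> carrier_vec N" using B by (simp add: v_def)
    have "A\<^sup>T *\<^sub>v v = vec N b"
      using B AT by (simp add: v_def assoc_mult_mat_vec[symmetric, OF AT B(1)])
    then have "(\<Sum>i = 0..<N. v $ i * a k (h i)) = b k"
      using row[OF v \<open>k < N\<close>] \<open>k < N\<close> by simp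
    then show "(\<Sum>j\<in>J. (B *\<^sub>v vec N b) $ (inv_into {0..<N} h j) * a k j) = b k"
      by (simp add: sum_h inv_h v_def)
  qed
  show "d j = 0" if d: "\<And>k. k < N \<Longrightarrow> (\<Sum>j\<in>J. d j * a k j) = 0" and "j \<in> J" for d j
  proof -
    define v where "v = vec N (d \<circ> h)"
    have v: "v \<in> carrier_vec N" by (simp add: v_def)
    have "A\<^sup>T *\<^sub>v v = 0\<^sub>v N"
    proof (rule eq_vecI)
      fix k assume "k < dim_vec (0\<^sub>v N :: 'a vec)"
      then show "(A\<^sup>T *\<^sub>v v) $ k = 0\<^sub>v N $ k"
        using row[OF v, of k] d[of k] by (simp add: sum_h v_def)
    qed (simp add: A_def)
    then have "v = 0\<^sub>v N" using det_0_iff_vec_prod_zero[OF AT] det v by auto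
    then have "v $ i = 0" if "i < N" for i using that by simp
    moreover obtain i where "i < N" "j = h i"
      using \<open>j \<in> J\<close> h by (auto simp: bij_betw_def)
    ultimately show ?thesis by (metis v_def index_vec comp_apply)
  qed
qed

section \<open>Polynomials in the graded monomial basis\<close>

lemma all_bimonom_iff_all_basis_monom:
  "(\<forall>t s. Q (cantor_pairing (t, s)) \<longrightarrow> R (bimonom t s)) \<longleftrightarrow> (\<forall>k. Q k \<longrightarrow> R (basis_monom k))"
proof -
  have "(\<forall>k. Q k \<longrightarrow> R (basis_monom k)) \<longleftrightarrow>
        (\<forall>z. Q (cantor_pairing z) \<longrightarrow> R (basis_monom (cantor_pairing z)))"
    using bij_cantor_pairing by (metis bij_pointE)
  then show ?thesis by (simp add: basis_monom_cantor_pairing)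
qed

lemma coeff_basis_monom:
  "coeff (coeff (basis_monom k) t) s = (if cantor_pairing (t, s) = k then 1 else 0)"
proof -
  obtain t' s' where k: "k = cantor_pairing (t', s')"
    using bij_cantor_pairing by (metis bij_pointE surj_pair)
  show ?thesis
    by (auto simp: k basis_monom_cantor_pairing bimonom_def inj_eq[OF bij_is_inj[OF bij_cantor_pairing]])
qed

lemma coeff_lin_comb:
  "coeff (coeff (lin_comb N c) t) s =
     (if cantor_pairing (t, s) < N then c (cantor_pairing (t, s)) else 0)"
  by (simp add: lin_comb_def coeff_sum coeff_basis_monom if_distrib cong: if_cong)

lemma lin_comb_cong: "(\<And>k. k < N \<Longrightarrow> c k = d k) \<Longrightarrow> lin_comb N c = lin_comb N d"
  by (simp add: lin_comb_def)

text \<open>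
  This independence of the monomials lets the uniqueness of a polynomial, in the definition of
  normality, be read as uniqueness of its coefficients.
\<close>

lemma lin_comb_eq_0_imp:
  assumes "lin_comb N c = 0" and "k < N"
  shows "c k = 0"
proof -
  obtain t s where k: "k = cantor_pairing (t, s)"
    using bij_cantor_pairing by (metis bij_pointE surj_pair)
  show ?thesis using coeff_lin_comb[of N c t s] assms by (simp add: k)
qed

lemma lin_comb_add: "lin_comb N (\<lambda>k. c k + d k) = lin_comb N c + lin_comb N d"
proof -
  have "[:c k + d k:] = [:c k:] + [:d k:]" for k by simp
  then show ?thesis unfolding lin_comb_def by (simp only: smult_add_left sum.distrib)
qed

lemma bieval_add: "bieval (p + q) z = bieval p z + bieval q z"
  by (simp add: bieval_def split: prod.split)

lemma bieval_mult: "bieval (p * q) z = bieval p z * bieval q z"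
  by (simp add: bieval_def split: prod.split)

lemma bieval_lin_comb: "bieval (lin_comb N c) z = (\<Sum>k<N. c k * bieval (basis_monom k) z)"
  by (simp add: bieval_def lin_comb_def poly_sum split: prod.split)

section \<open>The pairing on polynomials\<close>

lemma integrable_bieval:
  assumes "bivariate_measure M"
  shows "integrable M (bieval p)"
proof -
  have eq: "bieval p =
      (\<lambda>z. \<Sum>t\<le>degree p. \<Sum>s\<le>degree (coeff p t). coeff (coeff p t) s * (case z of (x, y) \<Rightarrow> x ^ t * y ^ s))"
    by (auto simp: bieval_def fun_eq_iff poly_altdef[of p] poly_sum poly_altdef[of "coeff p _"]
        sum_distrib_right sum_distrib_left poly_const_pow mult_ac intro!: sum.cong)
  show ?thesis
    unfolding eq using assms by (intro Bochner_Integration.integrable_sum integrable_mult_right)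
      (auto simp: bivariate_measure_def)
qed

lemma integrable_bieval_mult:
  assumes "bivariate_measure M"
  shows "integrable M (\<lambda>z. bieval p z * bieval q z)"
  using integrable_bieval[OF assms, of "p * q"] by (simp add: bieval_mult[abs_def])

lemma pairing_commute: "pairing M f g = pairing M g f"
  by (simp add: pairing_def mult.commute)

lemma pairing_add:
  assumes "bivariate_measure M"
  shows "pairing M (bieval (p + q)) (bieval u) =
         pairing M (bieval p) (bieval u) + pairing M (bieval q) (bieval u)"
  by (simp add: pairing_def bieval_add distrib_right integrable_bieval_mult[OF assms])

lemma pairing_lin_comb:
  assumes "bivariate_measure M"
  shows "pairing M (bieval (lin_comb N c)) (bieval u) =
         (\<Sum>k<N. c k * pairing M (bieval (basis_monom k)) (bieval u))"
  by (simp add: pairing_def bieval_lin_comb sum_distrib_right mult.assoc integrable_bieval_mult[OF assms])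

text \<open>
  The finite moments of \<open>M\<close> itself make polynomials times \<open>w\<close> integrable with respect to \<open>\<mu>\<close>, so
  the sum in the Type I function may be integrated term by term.
\<close>

lemma pairing_density:
  assumes w: "w \<in> borel_measurable \<mu>" "AE z in \<mu>. 0 \<le> w z"
    and M: "bivariate_measure M" "M = density \<mu> (\<lambda>z. ennreal (w z))"
  shows "integrable \<mu> (\<lambda>z. bieval p z * (bieval q z * w z))"
    and "(\<integral>z. bieval p z * (bieval q z * w z) \<partial>\<mu>) = pairing M (bieval p) (bieval q)"
proof -
  have int: "integrable M (\<lambda>z. bieval p z * bieval q z)"
    by (rule integrable_bieval_mult[OF M(1)])
  then have meas: "(\<lambda>z. bieval p z * bieval q z) \<in> borel_measurable \<mu>"
    using borel_measurable_integrable[OF int] unfolding M(2) by simp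
  show "integrable \<mu> (\<lambda>z. bieval p z * (bieval q z * w z))"
    using int integrable_density[OF meas w] M(2) by (simp add: mult_ac)
  show "(\<integral>z. bieval p z * (bieval q z * w z) \<partial>\<mu>) = pairing M (bieval p) (bieval q)"
    using integral_density[OF meas w] M(2) by (simp add: pairing_def mult_ac)
qed

section \<open>Normality and the Type I polynomials\<close>

lemma is_type_II_iff:
  "is_type_II M n P \<longleftrightarrow>
     (\<exists>c. P = basis_monom (msize n) + lin_comb (msize n) c) \<and>
     (\<forall>j. \<forall>l<n j. pairing (M j) (bieval P) (bieval (basis_monom l)) = 0)"
proof -
  have "(\<forall>t s. cantor_pairing (t, s) < n j \<longrightarrow>
          pairing (M j) (bieval P) (bieval (bimonom t s)) = 0) \<longleftrightarrow>
        (\<forall>l<n j. pairing (M j) (bieval P) (bieval (basis_monom l)) = 0)" for j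
    by (rule all_bimonom_iff_all_basis_monom)
  then show ?thesis by (simp add: is_type_II_def)
qed

text \<open>
  The two Type I conditions merge into one inhomogeneous system of \<open>msize n\<close> equations, with right
  hand side the last unit vector.
\<close>

lemma is_type_I_iff:
  "is_type_I M n A \<longleftrightarrow>
     (\<forall>j. \<exists>c. A j = lin_comb (n j) c) \<and>
     (\<forall>k<msize n. (\<Sum>j\<in>UNIV. pairing (M j) (bieval (A j)) (bieval (basis_monom k))) =
        (if k + 1 = msize n then 1 else 0))"
proof -
  let ?S = "\<lambda>q. \<Sum>j\<in>UNIV. pairing (M j) (bieval (A j)) (bieval q)"
  have "(\<forall>t s. cantor_pairing (t, s) + 2 \<le> msize n \<longrightarrow> ?S (bimonom t s) = 0) \<longleftrightarrow>
        (\<forall>k. k + 2 \<le> msize n \<longrightarrow> ?S (basis_monom k) = 0)"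
    by (rule all_bimonom_iff_all_basis_monom)
  moreover have "(\<forall>t s. cantor_pairing (t, s) + 1 = msize n \<longrightarrow> ?S (bimonom t s) = 1) \<longleftrightarrow>
        (\<forall>k. k + 1 = msize n \<longrightarrow> ?S (basis_monom k) = 1)"
    by (rule all_bimonom_iff_all_basis_monom)
  moreover have "(\<forall>k. k + 2 \<le> N \<longrightarrow> S k = 0) \<and> (\<forall>k. k + 1 = N \<longrightarrow> S k = 1) \<longleftrightarrow>
        (\<forall>k<N. S k = (if k + 1 = N then 1 else 0))" for N and S :: "nat \<Rightarrow> real"
  proof -
    have "k < N \<longleftrightarrow> k + 2 \<le> N \<or> k + 1 = N" "\<not> (k + 2 \<le> N \<and> k + 1 = N)" for k by arith+
    then show ?thesis by auto
  qed
  ultimately show ?thesis unfolding is_type_I_def by (simp only:)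
qed

text \<open>
  A vector \<open>c\<close> in the left kernel of the moment matrix could be added to the lower coefficients of
  the Type II polynomial without disturbing its orthogonality.
\<close>

lemma normal_index_imp_trivial_left_kernel:
  assumes M: "\<And>j. bivariate_measure (M j)" and "normal_index M n"
    and c: "\<And>j l. l < n j \<Longrightarrow>
      (\<Sum>k<msize n. c k * pairing (M j) (bieval (basis_monom k)) (bieval (basis_monom l))) = 0"
    and "k < msize n"
  shows "c k = 0"
proof -
  let ?N = "msize n"
  obtain P where P: "is_type_II M n P" and uniq: "\<And>P'. is_type_II M n P' \<Longrightarrow> P' = P"
    using \<open>normal_index M n\<close> by (auto simp: normal_index_def)
  obtain d where d: "P = basis_monom ?N + lin_comb ?N d"
    using P by (auto simp: is_type_II_iff)
  have "P + lin_comb ?N c = basis_monom ?N + lin_comb ?N (\<lambda>k. d k + c k)"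
    by (simp add: d lin_comb_add add.assoc)
  moreover have "pairing (M j) (bieval (P + lin_comb ?N c)) (bieval (basis_monom l)) = 0"
    if "l < n j" for j l
    using that P c[OF that] by (simp add: is_type_II_iff pairing_add[OF M] pairing_lin_comb[OF M])
  ultimately have "is_type_II M n (P + lin_comb ?N c)"
    unfolding is_type_II_iff by blast
  then have "lin_comb ?N c = 0" using uniq by fastforce
  then show ?thesis using lin_comb_eq_0_imp \<open>k < ?N\<close> by blast
qed

text \<open>
  The unknowns of the Type I system are the coefficients of all the \<open>A j\<close> together, indexed by the
  pairs \<open>(j, l)\<close> with \<open>l < n j\<close>. There are \<open>msize n\<close> of these, as many as there are equations.
\<close>

lemma normal_index_imp_unique_type_I:
  assumes M: "\<And>j. bivariate_measure (M j)" and n: "normal_index M n"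
  shows "\<exists>!A. is_type_I M n A"
proof -
  let ?N = "msize n"
  define J where "J = (SIGMA j:UNIV. {..<n j})"
  define a where
    "a k = (\<lambda>(j, l). pairing (M j) (bieval (basis_monom k)) (bieval (basis_monom l)))" for k
  have J: "finite J" "card J = ?N"
    by (simp_all add: J_def msize_def)
  have "c k = 0" if c: "\<forall>z\<in>J. (\<Sum>k<?N. c k * a k z) = 0" and k: "k < ?N" for c k
  proof (rule normal_index_imp_trivial_left_kernel[OF M n _ k])
    fix j l assume "l < n j"
    then show "(\<Sum>k<?N. c k * pairing (M j) (bieval (basis_monom k)) (bieval (basis_monom l))) = 0"
      using bspec[OF c, of "(j, l)"] by (simp add: J_def a_def)
  qed
  then have kernel: "\<forall>c. (\<forall>z\<in>J. (\<Sum>k<?N. c k * a k z) = 0) \<longrightarrow> (\<forall>k<?N. c k = 0)"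
    by blast
  note system = trivial_left_kernel_imp_uniquely_solvable[OF J kernel]
  have eval: "(\<Sum>j\<in>UNIV. pairing (M j) (bieval (lin_comb (n j) (\<lambda>l. d (j, l)))) (bieval (basis_monom k)))
      = (\<Sum>z\<in>J. d z * a k z)" for d k
  proof -
    have "(\<Sum>j\<in>UNIV. pairing (M j) (bieval (lin_comb (n j) (\<lambda>l. d (j, l)))) (bieval (basis_monom k)))
        = (\<Sum>j\<in>UNIV. \<Sum>l<n j. d (j, l) * a k (j, l))"
      unfolding a_def prod.case
      by (subst pairing_commute[of _ "bieval (basis_monom k)"]) (simp only: pairing_lin_comb[OF M])
    also have "\<dots> = (\<Sum>z\<in>J. d z * a k z)"
      unfolding J_def by (subst sum.Sigma) (auto simp: split_beta)
    finally show ?thesis .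
  qed
  have solution_iff: "is_type_I M n (\<lambda>j. lin_comb (n j) (\<lambda>l. d (j, l))) \<longleftrightarrow>
      (\<forall>k<?N. (\<Sum>z\<in>J. d z * a k z) = (if k + 1 = ?N then 1 else 0))" for d
    unfolding is_type_I_iff eval[of d] by blast
  have repr: "\<exists>d. A = (\<lambda>j. lin_comb (n j) (\<lambda>l. d (j, l)))" if "is_type_I M n A" for A
  proof -
    have "\<forall>j. \<exists>c. A j = lin_comb (n j) c"
      using \<open>is_type_I M n A\<close> by (simp add: is_type_I_iff)
    then obtain c where "\<forall>j. A j = lin_comb (n j) (c j)"
      by (rule choice[THEN exE])
    then show ?thesis
      by (intro exI[of _ "case_prod c"]) (simp add: fun_eq_iff)
  qed
  show ?thesis
  proof (rule ex_ex1I)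
    obtain d where "\<forall>k<?N. (\<Sum>z\<in>J. d z * a k z) = (if k + 1 = ?N then 1 else 0)"
      using system(1)[of "\<lambda>k. if k + 1 = ?N then 1 else 0"] by blast
    then have "is_type_I M n (\<lambda>j. lin_comb (n j) (\<lambda>l. d (j, l)))"
      by (simp only: solution_iff)
    then show "\<exists>A. is_type_I M n A" by blast
  next
    fix A B assume A: "is_type_I M n A" and B: "is_type_I M n B"
    obtain d e where d: "A = (\<lambda>j. lin_comb (n j) (\<lambda>l. d (j, l)))"
      and e: "B = (\<lambda>j. lin_comb (n j) (\<lambda>l. e (j, l)))"
      using repr[OF A] repr[OF B] by blast
    have "(\<Sum>z\<in>J. (d z - e z) * a k z) = 0" if "k < ?N" for k
      using A B that unfolding d e solution_iff by (simp add: left_diff_distrib sum_subtractf)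
    then have "d z - e z = 0" if "z \<in> J" for z
      using system(2)[of "\<lambda>z. d z - e z"] that by blast
    then have "d (j, l) = e (j, l)" if "l < n j" for j l
      using that by (simp add: J_def)
    then show "A = B"
      unfolding d e by (intro ext lin_comb_cong)
  qed
qed

section \<open>Biorthogonality\<close>

lemma pairing_type_I_function:
  assumes "\<And>j. bivariate_measure (M j)"
    and "\<And>j. w j \<in> borel_measurable \<mu>" and "\<And>j. AE z in \<mu>. 0 \<le> w j z"
    and "\<And>j. M j = density \<mu> (\<lambda>z. ennreal (w j z))"
  shows "pairing \<mu> (bieval p) (type_I_function M w m) =
         (\<Sum>j\<in>UNIV. pairing (M j) (bieval p) (bieval (type_I M m j)))"
proof -
  note density = pairing_density[OF assms(2) assms(3) assms(1) assms(4)]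
  have "pairing \<mu> (bieval p) (type_I_function M w m) =
        (\<integral>z. (\<Sum>j\<in>UNIV. bieval p z * (bieval (type_I M m j) z * w j z)) \<partial>\<mu>)"
    by (simp add: pairing_def type_I_function_def sum_distrib_left)
  also have "\<dots> = (\<Sum>j\<in>UNIV. \<integral>z. bieval p z * (bieval (type_I M m j) z * w j z) \<partial>\<mu>)"
    by (rule Bochner_Integration.integral_sum) (rule density(1))
  also have "\<dots> = (\<Sum>j\<in>UNIV. pairing (M j) (bieval p) (bieval (type_I M m j)))"
    by (intro sum.cong refl density(2))
  finally show ?thesis .
qed

theorem theorem4p4:
  fixes M :: "'r::finite \<Rightarrow> (real \<times> real) measure"
    and \<mu> :: "(real \<times> real) measure"
    and w :: "'r \<Rightarrow> real \<times> real \<Rightarrow> real"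
    and n m :: "'r \<Rightarrow> nat"
  assumes "\<And>j. bivariate_measure (M j)"
    and "bivariate_measure \<mu>"
    and "msupport \<mu> = (\<Union>j. msupport (M j))"
    and "\<And>j. absolutely_continuous \<mu> (M j)"
    and "\<And>j. w j \<in> borel_measurable \<mu>"
    and "\<And>j. AE p in \<mu>. 0 \<le> w j p"
    and "\<And>j. M j = density \<mu> (\<lambda>p. ennreal (w j p))"
    and "normal_index M n"
    and "normal_index M m"
  shows "(m \<le> n \<longrightarrow> pairing \<mu> (bieval (type_II M n)) (type_I_function M w m) = 0) \<and>
         (msize n + 2 \<le> msize m \<longrightarrow>
            pairing \<mu> (bieval (type_II M n)) (type_I_function M w m) = 0) \<and>
         (msize n + 1 = msize m \<longrightarrow>
            pairing \<mu> (bieval (type_II M n)) (type_I_function M w m) = 1)"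
proof -
  note M = assms(1)
  define P where "P = type_II M n"
  define A where "A = type_I M m"
  have P: "is_type_II M n P"
    using assms(8) unfolding P_def type_II_def normal_index_def by (rule theI')
  have A: "is_type_I M m A"
    using normal_index_imp_unique_type_I[OF M assms(9)] unfolding A_def type_I_def by (rule theI')
  have expand: "pairing \<mu> (bieval P) (type_I_function M w m) =
      (\<Sum>j\<in>UNIV. pairing (M j) (bieval P) (bieval (A j)))"
    unfolding A_def by (rule pairing_type_I_function[OF M assms(5) assms(6) assms(7)])
  have "(\<Sum>j\<in>UNIV. pairing (M j) (bieval P) (bieval (A j))) = 0" if "m \<le> n"
  proof (intro sum.neutral ballI)
    fix j
    obtain c where c: "A j = lin_comb (m j) c" using A by (auto simp: is_type_I_iff)
    have "pairing (M j) (bieval (basis_monom l)) (bieval P) = 0" if "l < m j" for l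
      using P that le_funD[OF \<open>m \<le> n\<close>, of j]
      by (subst pairing_commute) (auto simp: is_type_II_iff)
    then show "pairing (M j) (bieval P) (bieval (A j)) = 0"
      by (subst pairing_commute) (simp add: c pairing_lin_comb[OF M])
  qed
  moreover have "(\<Sum>j\<in>UNIV. pairing (M j) (bieval P) (bieval (A j))) =
      (if msize n + 1 = msize m then 1 else 0)" if less: "msize n < msize m"
  proof -
    obtain c where c: "P = basis_monom (msize n) + lin_comb (msize n) c"
      using P by (auto simp: is_type_II_iff)
    let ?S = "\<lambda>k. \<Sum>j\<in>UNIV. pairing (M j) (bieval (basis_monom k)) (bieval (A j))"
    have S: "?S k = (if k + 1 = msize m then 1 else 0)" if "k < msize m" for k
      using A that by (simp add: is_type_I_iff pairing_commute[of _ "bieval (basis_monom k)"])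
    have "(\<Sum>j\<in>UNIV. pairing (M j) (bieval P) (bieval (A j))) =
          ?S (msize n) + (\<Sum>k<msize n. c k * ?S k)"
      by (simp add: c pairing_add[OF M] pairing_lin_comb[OF M] sum.distrib sum_distrib_left
          sum.swap[of _ UNIV])
    also have "(\<Sum>k<msize n. c k * ?S k) = 0"
      using less by (intro sum.neutral) (auto simp: S)
    finally show ?thesis by (simp add: S[OF less])
  qed
  ultimately show ?thesis unfolding expand[unfolded P_def] P_def by auto
qed

end
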